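(* Let $0<q<\infty$, $1<p<\infty$, and let $T$ be a monotone quasilinear operator on $\mathfrak{M}^+(0,\infty)$. Assume that $w\in\mathcal{W}(0,\infty)$ and that $v\in\mathcal{W}(0,\infty)$ is such that $$\int_x^\infty v^{1-p'}(t)\,dt<\infty,\qquad x\in(0,\infty).$$ Then the inequality $$\left\| T\left(\int_x^{\infty} h\right)\right\|_{q,w,(0,\infty)}\le C\,\|h\|_{p,v,(0,\infty)},\qquad h\in\mathfrak{M}^+(0,\infty),$$ holds if and only if the inequality $$\left\|\left(T\left(\left(\int_x^{\infty} h\right)^{\frac1p}\right)\right)^p\right\|_{q/p,w,(0,\infty)}\le C^p\,\|h\|_{1,\Psi^{1-2p},(0,\infty)},\qquad h\in\mathfrak{M}^+(0,\infty),$$ holds, where $$\Psi(x)=\left(\int_x^\infty v^{1-p'}(t)\,dt\right)^{\frac{1}{p'+1}},\qquad x\in(0,\infty).$$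
   Context: $\mathfrak{M}(0,\infty)$ is the set of measurable functions on $(0,\infty)$; $\mathfrak{M}^+(0,\infty)$ is the subset of functions non-negative on $(0,\infty)$; $\mathcal{W}(0,\infty)$ is the set of weights, i.e. measurable functions that are positive almost everywhere on $(0,\infty)$. For $p\in(1,\infty)$, $p'=p/(p-1)$. For $s\in(0,\infty)$ and $\omega\in\mathfrak{M}^+(0,\infty)$, $\|f\|_{s,\omega,(0,\infty)}=\left(\int_0^\infty |f(x)|^s\omega(x)\,dx\right)^{1/s}$. A monotone quasilinear operator on $\mathfrak{M}^+(0,\infty)$ is a map $T:\mathfrak{M}^+(0,\infty)\to\mathfrak{M}^+(0,\infty)$ such that: (i) $T(\lambda f)=\lambda Tf$ for all $\lambda\ge0$ and $f\in\mathfrak{M}^+(0,\infty)$; (ii) there is a constant $c>0$, independent of $f,g$, such that $Tf(x)\le c\,Tg(x)$ for almost all $x$ whenever $f(x)\le g(x)$ for almost all $x$; (iii) there is a constant $c>0$, independent of $f,g$, such that $T(f+g)\le c\,(Tf+Tg)$ for all $f,g\in\mathfrak{M}^+(0,\infty)$. In expressions such as $T\left(\int_x^\infty h\right)$ the operator $T$ acts on the function $x\mapsto\int_x^\infty h(t)\,dt$, and $T\left(\left(\int_x^\infty h\right)^{1/p}\right)$ is $T$ applied to $x\mapsto\left(\int_x^\infty h(t)\,dt\right)^{1/p}$. An inequality "holds" if there is a constant $C>0$, independent of $h$, for which it is valid for all indicated $h$; the constant $C$ may vary from one inequality to another. Conventions: $0\cdot\infty=0$, $\infty/\infty=0$, $0/0=0$.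 *)

theory Defs
  imports "HOL-Analysis.Analysis"
begin

text \<open>
  A function on the half-line \<open>(0,\<infinity>)\<close> is represented by a total function on \<open>real\<close> of which only
  the values on \<open>{0<..}\<close> matter. Values lie in \<open>[0,\<infinity>]\<close>, because \<open>\<integral>\<^sub>x\<^sup>\<infinity> h\<close> may be infinite.
\<close>

definition Mplus :: "(real \<Rightarrow> ennreal) set" where
  "Mplus = borel_measurable (lebesgue_on {0<..})"

definition weights :: "(real \<Rightarrow> ennreal) set" where
  "weights = {w \<in> Mplus. AE x in lebesgue_on {0<..}. 0 < w x}"

text \<open>Real powers on \<open>[0,\<infinity>]\<close>: for \<open>r < 0\<close>, \<open>0\<^sup>r = \<infinity>\<close> and \<open>\<infinity>\<^sup>r = 0\<close>.\<close>

definition epowr :: "ennreal \<Rightarrow> real \<Rightarrow> ennreal" where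
  "epowr a r =
    (if r = 0 then 1
     else if a = 0 then (if 0 < r then 0 else \<infinity>)
     else if a = \<infinity> then (if 0 < r then \<infinity> else 0)
     else ennreal (enn2real a powr r))"

definition conj_exponent :: "real \<Rightarrow> real" where
  "conj_exponent p = p / (p - 1)"

definition weighted_norm :: "real \<Rightarrow> (real \<Rightarrow> ennreal) \<Rightarrow> (real \<Rightarrow> ennreal) \<Rightarrow> ennreal" where
  "weighted_norm s \<omega> f = epowr (\<integral>\<^sup>+ x. epowr (f x) s * \<omega> x \<partial>lebesgue_on {0<..}) (1 / s)"

definition tail_integral :: "(real \<Rightarrow> ennreal) \<Rightarrow> real \<Rightarrow> ennreal" where
  "tail_integral h x = (\<integral>\<^sup>+ t \<in> {x<..}. h t \<partial>lebesgue)"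

definition Psi :: "real \<Rightarrow> (real \<Rightarrow> ennreal) \<Rightarrow> real \<Rightarrow> ennreal" where
  "Psi p v x =
    epowr (tail_integral (\<lambda>t. epowr (v t) (1 - conj_exponent p)) x) (1 / (conj_exponent p + 1))"

text \<open>
  Equalities and inequalities between elements of \<open>Mplus\<close> are understood almost everywhere.
  Assumption \<open>depends_on_halfline\<close> is an artefact of the representation: it says that \<open>T\<close> does not see the
  values of its argument outside \<open>(0,\<infinity>)\<close>.
\<close>

locale monotone_quasilinear =
  fixes T :: "(real \<Rightarrow> ennreal) \<Rightarrow> (real \<Rightarrow> ennreal)"
  assumes maps_Mplus: "f \<in> Mplus \<Longrightarrow> T f \<in> Mplus"
    and depends_on_halfline: "f \<in> Mplus \<Longrightarrow> g \<in> Mplus \<Longrightarrow> (\<And>x. 0 < x \<Longrightarrow> f x = g x) \<Longrightarrow>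
      AE x in lebesgue_on {0<..}. T f x = T g x"
    and homogeneous_ae: "f \<in> Mplus \<Longrightarrow> 0 \<le> a \<Longrightarrow>
      AE x in lebesgue_on {0<..}. T (\<lambda>y. ennreal a * f y) x = ennreal a * T f x"
    and monotone_ae: "\<exists>c>0::real. \<forall>f\<in>Mplus. \<forall>g\<in>Mplus.
      (AE x in lebesgue_on {0<..}. f x \<le> g x) \<longrightarrow>
      (AE x in lebesgue_on {0<..}. T f x \<le> ennreal c * T g x)"
    and quasi_subadditive_ae: "\<exists>c>0::real. \<forall>f\<in>Mplus. \<forall>g\<in>Mplus.
      AE x in lebesgue_on {0<..}. T (\<lambda>y. f y + g y) x \<le> ennreal c * (T f x + T g x)"

end

theory Submission
  imports Defs
begin

text \<open>
  Let \<open>\<sigma> = v\<^sup>1\<^sup>-\<^sup>p\<^sup>'\<close> and let \<open>W x\<close> be its tail \<open>\<integral>\<^sub>x\<^sup>\<infinity> \<sigma>\<close>. The exponents are such that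
  \<open>\<Psi>\<^sup>1\<^sup>-\<^sup>2\<^sup>p = W\<^sup>1\<^sup>-\<^sup>p\<close>, so after taking \<open>p\<close>-th roots the second inequality bounds
  \<open>\<parallel>T((\<integral>\<^sub>x\<^sup>\<infinity> h)\<^sup>1\<^sup>/\<^sup>p)\<parallel>\<close> by a multiple of \<open>(\<integral> h W\<^sup>1\<^sup>-\<^sup>p)\<^sup>1\<^sup>/\<^sup>p\<close>, in the same norm as the first. The operator
  is monotone and homogeneous, so it is enough to compare the two families of arguments pointwise:

  \<^item> every root \<open>(\<integral>\<^sub>x\<^sup>\<infinity> h)\<^sup>1\<^sup>/\<^sup>p\<close> lies below a multiple of a tail \<open>\<integral>\<^sub>x\<^sup>\<infinity> f\<close> with \<open>\<integral> f\<^sup>p v \<le> \<integral> h W\<^sup>1\<^sup>-\<^sup>p\<close>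
    (\<open>tail_power_dominated\<close>), which takes the first inequality to the second;
  \<^item> every tail \<open>\<integral>\<^sub>x\<^sup>\<infinity> h\<close> lies below a multiple of a root \<open>(\<integral>\<^sub>x\<^sup>\<infinity> g)\<^sup>1\<^sup>/\<^sup>p\<close> with
    \<open>\<integral> g W\<^sup>1\<^sup>-\<^sup>p \<le> 2 \<integral> h\<^sup>p v\<close> (\<open>tail_dominated_by_power\<close>), which takes the second to the first.

  Both \<open>f\<close> and \<open>g\<close> are explicit. The estimates for them use only Tonelli's theorem and integrals of
  \<open>\<sigma> W\<^sup>s\<^sup>-\<^sup>1\<close>, which the substitution \<open>y = W x\<close> turns into integrals of powers of \<open>y\<close>
  (\<open>tail_substitution\<close>). Infinite values of the weight need no separate case: where \<open>W\<close> vanishes,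
  both right-hand sides are infinite unless \<open>h\<close> vanishes almost everywhere there.
\<close>

section \<open>Powers on the extended half-line and integrals of powers\<close>

lemma epowr_one [simp]: "epowr a 1 = a"
  by (cases a) (auto simp: epowr_def ennreal_eq_0_iff)

lemma epowr_zero_left: "0 < r \<Longrightarrow> epowr 0 r = 0"
  by (simp add: epowr_def)

lemma epowr_top_left: "0 < r \<Longrightarrow> epowr \<infinity> r = \<infinity>"
  by (simp add: epowr_def)

lemma epowr_ennreal: "0 < x \<Longrightarrow> epowr (ennreal x) r = ennreal (x powr r)"
  by (auto simp: epowr_def ennreal_eq_0_iff)

lemma epowr_ennreal_nonneg: "0 < r \<Longrightarrow> 0 \<le> x \<Longrightarrow> epowr (ennreal x) r = ennreal (x powr r)"
  by (cases "x = 0") (auto simp: epowr_ennreal epowr_zero_left)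

lemma ennreal_zero_pos_top_cases:
  obtains "a = 0" | "a = \<infinity>" | x where "0 < x" "a = ennreal x"
proof (cases a)
  case (real x)
  with that show ?thesis by (cases "x = 0") auto
qed (use that in auto)

lemma epowr_mult:
  assumes "0 < r" shows "epowr (a * b) r = epowr a r * epowr b r"
  using assms
  by (cases a rule: ennreal_zero_pos_top_cases; cases b rule: ennreal_zero_pos_top_cases)
    (auto simp: epowr_zero_left epowr_top_left[simplified] epowr_ennreal powr_mult ennreal_mult_top
      ennreal_top_mult ennreal_eq_0_iff simp flip: ennreal_mult)

lemma epowr_epowr:
  assumes "0 < r" shows "epowr (epowr a r) s = epowr a (r * s)"
proof (cases a rule: ennreal_zero_pos_top_cases)
  case (3 x)
  then show ?thesis using assms by (simp add: epowr_ennreal powr_powr)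
qed (use assms in \<open>auto simp: epowr_def zero_less_mult_iff\<close>)

lemma epowr_mono:
  assumes "0 < r" "a \<le> b" shows "epowr a r \<le> epowr b r"
  using assms
  by (cases a; cases b)
    (auto simp: epowr_ennreal_nonneg epowr_top_left[simplified] top_unique intro!: ennreal_leI powr_mono2)

lemma epowr_add:
  assumes "0 < r" "0 < s" shows "epowr a (r + s) = epowr a r * epowr a s"
  using assms
  by (cases a rule: ennreal_zero_pos_top_cases)
    (auto simp: epowr_zero_left epowr_top_left[simplified] epowr_ennreal powr_add ennreal_top_mult
      simp flip: ennreal_mult)

text \<open>
  Raising to a positive power is an order automorphism of \<open>[0,\<infinity>]\<close>. This turns the second
  inequality of the theorem into one for the \<open>q\<close>-norm.
\<close>

lemma epowr_le_iff_root:
  assumes "0 < p" shows "epowr a p \<le> b \<longleftrightarrow> a \<le> epowr b (1 / p)"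
  using epowr_mono[of p a "epowr b (1 / p)"] epowr_mono[of "1 / p" "epowr a p" b] assms
  by (auto simp: epowr_epowr)

lemma epowr_measurable [measurable]: "(\<lambda>a. epowr a r) \<in> borel_measurable borel"
  unfolding epowr_def by measurable

text \<open>
  The left endpoint may be \<open>0\<close> when \<open>s > 0\<close>: the primitive is then still continuous there, and
  the fundamental theorem asks for its derivative only in the interior.
\<close>

lemma powr_has_integral_Icc:
  fixes c d s :: real
  assumes "0 \<le> c" "c \<le> d" "s \<noteq> 0" "0 < c \<or> 0 < s"
  shows "((\<lambda>y. y powr (s - 1)) has_integral (d powr s - c powr s) / s) {c..d}"
proof -
  have "((\<lambda>y. y powr (s - 1)) has_integral (d powr s / s - c powr s / s)) {c..d}"
  proof (rule fundamental_theorem_of_calculus_interior)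
    show "continuous_on {c..d} (\<lambda>y. y powr s / s)"
      using assms
      by (intro continuous_on_divide continuous_on_powr' continuous_on_id continuous_on_const) auto
    fix y assume "y \<in> {c<..<d}"
    then have "0 < y" using assms by auto
    then have "((\<lambda>y. y powr s / s) has_real_derivative (y powr (s - 1))) (at y)"
      using assms by (auto intro!: derivative_eq_intros)
    then show "((\<lambda>y. y powr s / s) has_vector_derivative y powr (s - 1)) (at y)"
      by (simp add: has_real_derivative_iff_has_vector_derivative)
  qed (use assms in auto)
  then show ?thesis by (simp add: diff_divide_distrib)
qed

lemma nn_integral_powr_Icc:
  fixes c d s :: real
  assumes "0 \<le> c" "c \<le> d" "s \<noteq> 0" "0 < c \<or> 0 < s"
  shows "(\<integral>\<^sup>+ y. ennreal (y powr (s - 1)) * indicator {c..d} y \<partial>lborel)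
    = ennreal ((d powr s - c powr s) / s)"
  by (rule nn_integral_has_integral_lebesgue'[OF _ powr_has_integral_Icc[OF assms]]) simp

section \<open>Integration over the half-line\<close>

abbreviation half_line :: "real measure"
  where "half_line \<equiv> lebesgue_on {0<..}"

lemma sigma_finite_lebesgue: "sigma_finite_measure (lebesgue :: real measure)"
proof
  obtain A :: "real set set" where "countable A" "A \<subseteq> sets lborel" "\<Union>A = space lborel"
    "\<forall>a\<in>A. emeasure lborel a \<noteq> \<infinity>"
    using lborel.sigma_finite_countable by blast
  then show "\<exists>A::real set set. countable A \<and> A \<subseteq> sets lebesgue \<and> \<Union>A = space lebesgue
      \<and> (\<forall>a\<in>A. emeasure lebesgue a \<noteq> \<infinity>)"
    by (intro exI[of _ A]) auto
qed

lemma sigma_finite_half_line: "sigma_finite_measure half_line"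
  by (intro sigma_finite_measure_restrict_space sigma_finite_lebesgue) auto

interpretation half_line: sigma_finite_measure half_line
  by (rule sigma_finite_half_line)

interpretation half_line_pair: pair_sigma_finite half_line half_line ..

lemma ident_measurable_half_line [measurable]: "(\<lambda>x. x) \<in> borel_measurable half_line"
  by (intro measurable_restrict_space1 measurable_completion) simp

lemma indicator_greaterThan: "indicator {x<..} u = (if x < u then 1 else 0)"
  by (auto simp: indicator_def)

lemma indicator_lessThan: "indicator {..<u} x = (if x < u then 1 else 0)"
  by (auto simp: indicator_def)

lemma tail_integral_half_line:
  assumes "0 \<le> x"
  shows "tail_integral h x = (\<integral>\<^sup>+ t. h t * indicator {x<..} t \<partial>half_line)"
  using assms unfolding tail_integral_def
  by (subst nn_integral_restrict_space) (auto simp: indicator_def intro!: nn_integral_cong)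

lemma tail_integral_measurable:
  assumes [measurable]: "h \<in> borel_measurable half_line"
  shows "tail_integral h \<in> borel_measurable half_line"
proof -
  have "(\<lambda>x. \<integral>\<^sup>+ t. h t * indicator {x<..} t \<partial>half_line) \<in> borel_measurable half_line"
    unfolding indicator_greaterThan by measurable
  then show ?thesis
    by (subst measurable_cong[where g="\<lambda>x. \<integral>\<^sup>+ t. h t * indicator {x<..} t \<partial>half_line"])
      (auto simp: tail_integral_half_line)
qed

text \<open>
  Tonelli on the triangle \<open>0 < t < u\<close>. Every exchange of the order of integration below is this one;
  a lower cut-off is absorbed into \<open>a\<close> or \<open>b\<close>.
\<close>

lemma tonelli_triangle:
  assumes [measurable]: "a \<in> borel_measurable half_line" "b \<in> borel_measurable half_line"
  shows "(\<integral>\<^sup>+ t. a t * (\<integral>\<^sup>+ u. b u * indicator {t<..} u \<partial>half_line) \<partial>half_line)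
       = (\<integral>\<^sup>+ u. b u * (\<integral>\<^sup>+ t. a t * indicator {..<u} t \<partial>half_line) \<partial>half_line)"
proof -
  have "(\<integral>\<^sup>+ t. a t * (\<integral>\<^sup>+ u. b u * indicator {t<..} u \<partial>half_line) \<partial>half_line)
      = (\<integral>\<^sup>+ t. \<integral>\<^sup>+ u. a t * (b u * indicator {t<..} u) \<partial>half_line \<partial>half_line)"
    by (intro nn_integral_cong nn_integral_cmult[symmetric]) (auto simp: indicator_greaterThan)
  also have "\<dots> = (\<integral>\<^sup>+ u. \<integral>\<^sup>+ t. a t * (b u * indicator {t<..} u) \<partial>half_line \<partial>half_line)"
    unfolding indicator_greaterThan by (rule half_line_pair.Fubini'[symmetric]) measurable
  also have "\<dots> = (\<integral>\<^sup>+ u. \<integral>\<^sup>+ t. b u * (a t * indicator {..<u} t) \<partial>half_line \<partial>half_line)"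
    by (intro nn_integral_cong) (auto simp: indicator_def mult.commute)
  also have "\<dots> = (\<integral>\<^sup>+ u. b u * (\<integral>\<^sup>+ t. a t * indicator {..<u} t \<partial>half_line) \<partial>half_line)"
    by (intro nn_integral_cong nn_integral_cmult) (auto simp: indicator_lessThan)
  finally show ?thesis .
qed

section \<open>Densities with finite tails\<close>

text \<open>
  The tail of the density is used as a new variable. Its finiteness is what allows \<open>W\<close> to be
  real-valued.
\<close>

locale finite_tail =
  fixes \<sigma> :: "real \<Rightarrow> ennreal"
  assumes density_measurable [measurable]: "\<sigma> \<in> borel_measurable half_line"
    and tail_finite: "0 < x \<Longrightarrow> tail_integral \<sigma> x < \<infinity>"
begin

definition W :: "real \<Rightarrow> real"
  where "W x = enn2real (tail_integral \<sigma> x)"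

lemma W_nonneg [simp]: "0 \<le> W x"
  by (simp add: W_def)

lemma tail_eq_W: "0 < x \<Longrightarrow> tail_integral \<sigma> x = ennreal (W x)"
  using tail_finite[of x] by (simp add: W_def)

lemma W_antimono: "0 < x \<Longrightarrow> x \<le> y \<Longrightarrow> W y \<le> W x"
  unfolding W_def using tail_finite[of x]
  by (intro enn2real_mono)
    (auto simp: tail_integral_half_line indicator_def intro!: nn_integral_mono)

lemma W_measurable [measurable]: "W \<in> borel_measurable half_line"
  unfolding W_def using tail_integral_measurable[OF density_measurable] by measurable

text \<open>
  Continuity of the tail and its decay at infinity are both dominated convergence for the indicators
  of \<open>{X n<..}\<close>. The exceptional point \<open>t\<close> is the limit of the \<open>X n\<close>, where indicators need not
  converge.
\<close>

lemma tail_tendsto: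
  assumes "0 < x" "\<And>n. x \<le> X n"
    and "\<And>u. u \<noteq> t \<Longrightarrow> (\<lambda>n. indicator {X n<..} u :: ennreal) \<longlonglongrightarrow> indicator A u"
    and "A \<subseteq> {x<..}" and [measurable]: "A \<in> sets borel"
  shows "(\<lambda>n. \<integral>\<^sup>+ u. \<sigma> u * indicator {X n<..} u \<partial>half_line)
    \<longlonglongrightarrow> (\<integral>\<^sup>+ u. \<sigma> u * indicator A u \<partial>half_line)"
proof (rule nn_integral_dominated_convergence[where w="\<lambda>u. \<sigma> u * indicator {x<..} u"])
  show "(\<integral>\<^sup>+ u. \<sigma> u * indicator {x<..} u \<partial>half_line) < \<infinity>"
    using assms(1) tail_finite[of x] by (simp add: tail_integral_half_line)
  have "AE u in half_line. u \<noteq> t"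
    by (subst AE_restrict_space_iff) (auto intro!: AE_completion intro: AE_mp[OF AE_lborel_singleton[of t]])
  moreover have "AE u in half_line. \<sigma> u * indicator {x<..} u < \<infinity>"
    using assms(1) tail_finite[of x]
    by (simp add: tail_integral_half_line)
       (use nn_integral_PInf_AE[of "\<lambda>u. \<sigma> u * indicator {x<..} u" half_line] in \<open>simp add: less_top\<close>)
  ultimately show "AE u in half_line. (\<lambda>n. \<sigma> u * indicator {X n<..} u) \<longlonglongrightarrow> \<sigma> u * indicator A u"
  proof eventually_elim
    case (elim u)
    then have "(\<lambda>n. (\<sigma> u * indicator {x<..} u) * indicator {X n<..} u)
        \<longlonglongrightarrow> (\<sigma> u * indicator {x<..} u) * indicator A u"
      by (intro ennreal_tendsto_cmult assms(3)) auto
    moreover have "(\<sigma> u * indicator {x<..} u) * indicator {X n<..} u = \<sigma> u * indicator {X n<..} u" for n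
      using assms(2)[of n] by (auto simp: indicator_def)
    moreover have "(\<sigma> u * indicator {x<..} u) * indicator A u = \<sigma> u * indicator A u"
      using assms(4) by (auto simp: indicator_def)
    ultimately show ?case by simp
  qed
qed (use assms in \<open>auto simp: indicator_def intro: order.strict_trans1\<close>)

lemma tail_sequence:
  assumes "0 < x" "\<And>n. x \<le> X n"
    and "\<And>u. u \<noteq> t \<Longrightarrow> (\<lambda>n. indicator {X n<..} u :: ennreal) \<longlonglongrightarrow> indicator A u"
    and "A \<subseteq> {x<..}" "A \<in> sets borel"
  shows "(\<lambda>n. ennreal (W (X n))) \<longlonglongrightarrow> (\<integral>\<^sup>+ u. \<sigma> u * indicator A u \<partial>half_line)"
proof -
  have "ennreal (W (X n)) = (\<integral>\<^sup>+ u. \<sigma> u * indicator {X n<..} u \<partial>half_line)" for n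
    using assms(1) assms(2)[of n] by (simp flip: tail_eq_W add: tail_integral_half_line)
  then show ?thesis using tail_tendsto[OF assms] by simp
qed

lemma W_continuous: "0 < x \<Longrightarrow> continuous_on {x..} W"
  unfolding continuous_on_sequentially
proof (intro allI ballI impI, elim conjE)
  fix X t assume x: "0 < x" "t \<in> {x..}" and X: "\<forall>n. X n \<in> {x..}" "X \<longlonglongrightarrow> t"
  have "(\<lambda>n. ennreal (W (X n))) \<longlonglongrightarrow> (\<integral>\<^sup>+ u. \<sigma> u * indicator {t<..} u \<partial>half_line)"
  proof (rule tail_sequence[OF x(1)])
    fix u :: real assume "u \<noteq> t"
    have "eventually (\<lambda>n. indicator {X n<..} u = (indicator {t<..} u :: ennreal)) sequentially"
    proof (cases "u < t")
      case True
      then show ?thesis using order_tendstoD(1)[OF X(2) True] by (auto elim: eventually_mono)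
    next
      case False
      then have "t < u" using \<open>u \<noteq> t\<close> by simp
      from order_tendstoD(2)[OF X(2) this] show ?thesis
        by eventually_elim (use \<open>t < u\<close> in auto)
    qed
    then show "(\<lambda>n. indicator {X n<..} u :: ennreal) \<longlonglongrightarrow> indicator {t<..} u"
      by (rule tendsto_eventually)
  qed (use x X in auto)
  then have "(\<lambda>n. ennreal (W (X n))) \<longlonglongrightarrow> ennreal (W t)"
    using x by (simp flip: tail_eq_W add: tail_integral_half_line)
  then show "(W \<circ> X) \<longlonglongrightarrow> W t" by (simp add: comp_def)
qed

lemma W_tendsto_zero: "(\<lambda>n. W (1 + real n)) \<longlonglongrightarrow> 0"
proof -
  have "(\<lambda>n. ennreal (W (1 + real n))) \<longlonglongrightarrow> (\<integral>\<^sup>+ u. \<sigma> u * indicator {} u \<partial>half_line)"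
  proof (rule tail_sequence[of 1 _ 0])
    fix u :: real
    have "eventually (\<lambda>n. u < 1 + real n) sequentially" by real_asymp
    then show "(\<lambda>n. indicator {1 + real n<..} u :: ennreal) \<longlonglongrightarrow> indicator {} u"
      by (intro tendsto_eventually) (auto elim!: eventually_mono)
  qed auto
  then have "(\<lambda>n. ennreal (W (1 + real n))) \<longlonglongrightarrow> ennreal 0" by simp
  then show ?thesis by (subst (asm) tendsto_ennreal_iff) auto
qed

lemma W_attains:
  assumes "0 < x" "0 < y" "y \<le> W x"
  obtains t where "x \<le> t" "W t = y"
proof -
  obtain n where n: "W (1 + real n) < y" "x \<le> 1 + real n"
  proof -
    have "eventually (\<lambda>n. x \<le> 1 + real n) sequentially" by real_asymp
    from eventually_happens[OF eventually_conj[OF this order_tendstoD(2)[OF W_tendsto_zero assms(2)]]]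
    show ?thesis using that by auto
  qed
  have "\<exists>t. x \<le> t \<and> t \<le> 1 + real n \<and> W t = y"
    using n assms by (intro IVT2' continuous_on_subset[OF W_continuous[OF assms(1)]]) auto
  then show ?thesis using that by blast
qed

text \<open>
  The substitution \<open>y = W u\<close> carries \<open>\<sigma> u du\<close> on \<open>(x,\<infinity>)\<close> to Lebesgue measure on \<open>[0, W x]\<close>. By
  the intermediate value theorem a level \<open>0 < y \<le> W x\<close> is attained at some \<open>t\<close>, and up to the
  plateau of height \<open>y\<close> the set \<open>{u. y < W u}\<close> is \<open>(x,t]\<close>, of mass \<open>W x - W t\<close>. Half-lines determine a
  finite Borel measure.
\<close>

lemma distr_tail:
  assumes "0 < x"
  shows "distr (density half_line (\<lambda>u. \<sigma> u * indicator {x<..} u)) borel W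
    = density lborel (indicator {0..W x})" (is "distr ?N borel W = ?R")
proof (rule measure_eqI_lessThan)
  have N: "emeasure (distr ?N borel W) {y<..}
      = (\<integral>\<^sup>+ u. \<sigma> u * indicator {x<..} u * indicator {u. y < W u} u \<partial>half_line)" for y
  proof -
    have [measurable]: "(\<lambda>u. \<sigma> u * indicator {x<..} u) \<in> borel_measurable half_line"
      unfolding indicator_greaterThan by measurable
    have [measurable]: "W -` {y<..} \<inter> space half_line \<in> sets half_line" by measurable
    have "emeasure (distr ?N borel W) {y<..} = emeasure ?N (W -` {y<..} \<inter> space half_line)"
      by (subst emeasure_distr) auto
    also have "\<dots> = (\<integral>\<^sup>+ u. \<sigma> u * indicator {x<..} u * indicator (W -` {y<..} \<inter> space half_line) u \<partial>half_line)"
      by (rule emeasure_density) measurable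
    finally show ?thesis by (auto intro!: nn_integral_cong simp: indicator_def)
  qed
  have tot: "(\<integral>\<^sup>+ u. \<sigma> u * indicator {x<..} u \<partial>half_line) = ennreal (W x)"
    using assms by (simp flip: tail_eq_W add: tail_integral_half_line)
  have interval: "(\<integral>\<^sup>+ u. \<sigma> u * indicator {x<..t} u \<partial>half_line) = ennreal (W x - W t)" if "x \<le> t" for t
  proof -
    have "ennreal (W x) = (\<integral>\<^sup>+ u. \<sigma> u * indicator {x<..t} u + \<sigma> u * indicator {t<..} u \<partial>half_line)"
      using that by (auto simp flip: tot intro!: nn_integral_cong split: split_indicator)
    also have "\<dots> = (\<integral>\<^sup>+ u. \<sigma> u * indicator {x<..t} u \<partial>half_line) + ennreal (W t)"
      using assms that
      by (subst nn_integral_add) (auto simp flip: tail_eq_W simp: tail_integral_half_line)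
    finally show ?thesis
      by (simp add: ennreal_minus ennreal_minus_if ennreal_eq_0_iff flip: ennreal_minus)
  qed
  fix y
  show fin: "emeasure (distr ?N borel W) {y<..} < \<infinity>"
  proof -
    have "emeasure (distr ?N borel W) {y<..} \<le> ennreal (W x)"
      unfolding N tot[symmetric] by (intro nn_integral_mono) (auto simp: indicator_def)
    then show ?thesis using order.strict_trans1 by force
  qed
  have R: "emeasure ?R {y<..} = emeasure lborel ({0..W x} \<inter> {y<..})"
    by (subst emeasure_density) (auto simp flip: nn_integral_indicator indicator_inter_arith intro!: nn_integral_cong)
  \<comment> \<open>A slightly higher level is used: a plateau of height exactly \<open>y\<close> lies outside \<open>{u. y < W u}\<close>.\<close>
  have ge: "ennreal (W x - y) \<le> emeasure (distr ?N borel W) {y<..}" if y: "0 \<le> y" "y < W x"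
  proof (rule ennreal_le_epsilon)
    fix e :: real assume e: "0 < e"
    define y' where "y' = min (W x) (y + e)"
    have y': "0 < y'" "y' \<le> W x" "y < y'" "y' \<le> y + e" using y e by (auto simp: y'_def)
    obtain t where t: "x \<le> t" "W t = y'" using W_attains[OF assms y'(1,2)] by blast
    have "ennreal (W x - y') \<le> emeasure (distr ?N borel W) {y<..}"
      unfolding N t(2)[symmetric] interval[OF t(1), symmetric]
      using W_antimono[of _ t] assms t y'
      by (intro nn_integral_mono) (force simp: indicator_def)
    moreover have "ennreal (W x - y) \<le> ennreal (W x - y') + ennreal e"
      using y' e by (simp flip: ennreal_plus add: ennreal_leI)
    ultimately show "ennreal (W x - y) \<le> emeasure (distr ?N borel W) {y<..} + ennreal e"
      by (meson add_right_mono order_trans)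
  qed
  have le: "emeasure (distr ?N borel W) {y<..} \<le> ennreal (W x - y)" if y: "0 < y" "y < W x"
  proof -
    obtain t where t: "x \<le> t" "W t = y" using W_attains[OF assms y(1)] y by auto
    have "u \<le> t" if "W t < W u" "x < u" for u using that W_antimono[of t u] t assms by force
    then show ?thesis
      unfolding N t(2)[symmetric] interval[OF t(1), symmetric]
      by (intro nn_integral_mono) (auto simp: indicator_def)
  qed
  consider "y < 0" | "y = 0" "0 < W x" | "0 < y" "y < W x" | "W x \<le> y" "0 \<le> y"
    using W_nonneg[of x] by linarith
  then show "emeasure (distr ?N borel W) {y<..} = emeasure ?R {y<..}"
  proof cases
    case 1
    then have "{0..W x} \<inter> {y<..} = {0..W x}" "y < W u" for u
      using order.strict_trans2[OF 1 W_nonneg] by auto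
    then show ?thesis unfolding N R by (simp add: tot[symmetric])
  next
    case 2
    have "emeasure (distr ?N borel W) {y<..} \<le> ennreal (W x)"
      unfolding N tot[symmetric] by (intro nn_integral_mono) (auto simp: indicator_def)
    moreover have "{0..W x} \<inter> {y<..} = {0<..W x}" using 2 by auto
    ultimately show ?thesis using 2 ge unfolding R by simp
  next
    case 3
    then have "{0..W x} \<inter> {y<..} = {y<..W x}" by auto
    then show ?thesis using 3 ge le unfolding R by (simp add: order_antisym)
  next
    case 4
    have "\<not> y < W u" if "x < u" for u using W_antimono[of x u] that assms 4 by auto
    then have "emeasure (distr ?N borel W) {y<..} = (\<integral>\<^sup>+ u. 0 \<partial>half_line)"
      unfolding N by (intro nn_integral_cong) (auto simp: indicator_def)
    moreover have "{0..W x} \<inter> {y<..} = {}" using 4 by auto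
    ultimately show ?thesis unfolding R by simp
  qed
qed auto

lemma tail_substitution:
  assumes "0 < x" and [measurable]: "\<phi> \<in> borel_measurable borel"
  shows "(\<integral>\<^sup>+ u. \<sigma> u * \<phi> (W u) * indicator {x<..} u \<partial>half_line)
    = (\<integral>\<^sup>+ y. \<phi> y * indicator {0..W x} y \<partial>lborel)"
proof -
  let ?N = "density half_line (\<lambda>u. \<sigma> u * indicator {x<..} u)"
  have [measurable]: "(\<lambda>u. \<sigma> u * indicator {x<..} u) \<in> borel_measurable half_line"
    unfolding indicator_greaterThan by measurable
  have "(\<integral>\<^sup>+ u. \<sigma> u * \<phi> (W u) * indicator {x<..} u \<partial>half_line) = (\<integral>\<^sup>+ u. \<phi> (W u) \<partial>?N)"
    by (subst nn_integral_density) (auto simp: ac_simps)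
  also have "\<dots> = (\<integral>\<^sup>+ y. \<phi> y \<partial>distr ?N borel W)"
    by (subst nn_integral_distr) auto
  also have "\<dots> = (\<integral>\<^sup>+ y. \<phi> y * indicator {0..W x} y \<partial>lborel)"
    unfolding distr_tail[OF assms(1)] by (subst nn_integral_density) (auto simp: ac_simps)
  finally show ?thesis .
qed

lemma integral_powr_tail:
  assumes "0 < x" "0 < s"
  shows "(\<integral>\<^sup>+ u. \<sigma> u * ennreal (W u powr (s - 1)) * indicator {x<..} u \<partial>half_line)
    = ennreal (W x powr s / s)"
  using assms by (subst tail_substitution) (auto simp: nn_integral_powr_Icc)

text \<open>
  The increment of \<open>W\<^sup>s\<close> between \<open>t\<close> and \<open>x\<close> as an integral, in the form of an upper bound for
  \<open>W x powr s\<close>. Since \<open>W t < W u\<close> forces \<open>u < t\<close>, the substitution may be cut off at the level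
  \<open>W t\<close>.
\<close>

lemma powr_le_integral_between:
  assumes "0 < x" "x \<le> t" "0 < s"
  shows "ennreal (W x powr s) \<le> ennreal (W t powr s)
    + ennreal s * (\<integral>\<^sup>+ u. \<sigma> u * ennreal (W u powr (s - 1)) * indicator {x<..} u * indicator {..<t} u \<partial>half_line)"
proof -
  have Wt: "W t \<le> W x" using assms W_antimono by auto
  have "ennreal ((W x powr s - W t powr s) / s)
      = (\<integral>\<^sup>+ y. ennreal (y powr (s - 1)) * indicator {W t..W x} y \<partial>lborel)"
    using assms Wt by (subst nn_integral_powr_Icc) auto
  also have "\<dots> = (\<integral>\<^sup>+ y. ennreal (y powr (s - 1)) * indicator {W t<..} y * indicator {0..W x} y \<partial>lborel)"
    using AE_lborel_singleton[of "W t"] order.trans[OF W_nonneg[of t] less_imp_le]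
    by (intro nn_integral_cong_AE) (elim eventually_mono, auto simp: indicator_def)
  also have "\<dots> = (\<integral>\<^sup>+ u. \<sigma> u * (ennreal (W u powr (s - 1)) * indicator {W t<..} (W u)) * indicator {x<..} u \<partial>half_line)"
    using assms by (subst tail_substitution) auto
  also have "\<dots> \<le> (\<integral>\<^sup>+ u. \<sigma> u * ennreal (W u powr (s - 1)) * indicator {x<..} u * indicator {..<t} u \<partial>half_line)"
  proof (rule nn_integral_mono)
    fix u
    have "u < t" if "W t < W u" using that W_antimono[of t u] assms by (cases "u < t") auto
    then show "\<sigma> u * (ennreal (W u powr (s - 1)) * indicator {W t<..} (W u)) * indicator {x<..} u
        \<le> \<sigma> u * ennreal (W u powr (s - 1)) * indicator {x<..} u * indicator {..<t} u"
      by (auto simp: indicator_def)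
  qed
  finally have *: "ennreal ((W x powr s - W t powr s) / s) \<le> (\<integral>\<^sup>+ u. \<sigma> u * ennreal (W u powr (s - 1)) * indicator {x<..} u * indicator {..<t} u \<partial>half_line)" .
  have "W t powr s \<le> W x powr s" using Wt assms by (intro powr_mono2) auto
  then have "ennreal (W x powr s) = ennreal (W t powr s) + ennreal s * ennreal ((W x powr s - W t powr s) / s)"
    using assms by (simp flip: ennreal_plus ennreal_mult)
  with * show ?thesis by (auto intro!: mult_left_mono add_left_mono)
qed

text \<open>
  The tail may tend to infinity at the origin, so the substitution is applied on \<open>(x,t)\<close> and \<open>x\<close> is
  sent to \<open>0\<close>; the bound is uniform because the exponent is negative.
\<close>

lemma integral_neg_powr_before:
  assumes "0 < t" "0 < W t" "0 < s"
  shows "(\<integral>\<^sup>+ u. \<sigma> u * ennreal (W u powr (- s - 1)) * indicator {..<t} u \<partial>half_line)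
    \<le> ennreal (W t powr (- s) / s)"
proof -
  let ?f = "\<lambda>u. \<sigma> u * ennreal (W u powr (- s - 1)) * indicator {..<t} u"
  have "(\<integral>\<^sup>+ u. ?f u \<partial>half_line) = (\<integral>\<^sup>+ u. (SUP n. ?f u * indicator {1 / Suc n<..} u) \<partial>half_line)"
  proof (rule nn_integral_cong)
    fix u assume "u \<in> space half_line"
    then obtain n where n: "1 / real (Suc n) < u"
      using nat_approx_posE[of u] by auto
    show "?f u = (SUP n. ?f u * indicator {1 / real (Suc n)<..} u)"
    proof (rule antisym)
      show "?f u \<le> (SUP n. ?f u * indicator {1 / real (Suc n)<..} u)"
        using n by (intro SUP_upper2[of n]) auto
    qed (auto intro!: SUP_least simp: indicator_def)
  qed
  also have "\<dots> = (SUP n. \<integral>\<^sup>+ u. ?f u * indicator {1 / Suc n<..} u \<partial>half_line)"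
  proof (rule nn_integral_monotone_convergence_SUP)
    show "incseq (\<lambda>n u. ?f u * indicator {1 / real (Suc n)<..} u)"
    proof (intro incseq_SucI le_funI mult_left_mono)
      fix n u
      have "1 / real (Suc (Suc n)) \<le> 1 / real (Suc n)" by (simp add: frac_le)
      then show "indicator {1 / real (Suc n)<..} u \<le> (indicator {1 / real (Suc (Suc n))<..} u :: ennreal)"
        unfolding indicator_greaterThan by (auto dest: order.strict_trans1)
    qed simp
  qed (unfold indicator_greaterThan indicator_lessThan, measurable)
  also have "\<dots> \<le> ennreal (W t powr (- s) / s)"
  proof (rule SUP_least)
    fix n
    define x where "x = min t (1 / real (Suc n))"
    have x: "0 < x" "x \<le> t" using assms by (auto simp: x_def)
    have Wt: "W t \<le> W x" using W_antimono[OF x] .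
    have "(\<integral>\<^sup>+ u. ?f u * indicator {1 / Suc n<..} u \<partial>half_line)
        \<le> (\<integral>\<^sup>+ u. \<sigma> u * (ennreal (W u powr (- s - 1)) * indicator {W t..} (W u)) * indicator {x<..} u \<partial>half_line)"
    proof (rule nn_integral_mono)
      fix u assume "u \<in> space half_line"
      then have "u < t \<Longrightarrow> W t \<le> W u" using W_antimono[of u t] by auto
      then show "?f u * indicator {1 / Suc n<..} u
          \<le> \<sigma> u * (ennreal (W u powr (- s - 1)) * indicator {W t..} (W u)) * indicator {x<..} u"
        by (auto simp: indicator_def x_def)
    qed
    also have "\<dots> = (\<integral>\<^sup>+ y. ennreal (y powr (- s - 1)) * indicator {W t..} y * indicator {0..W x} y \<partial>lborel)"
      using x by (subst tail_substitution) auto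
    also have "\<dots> = (\<integral>\<^sup>+ y. ennreal (y powr (- s - 1)) * indicator {W t..W x} y \<partial>lborel)"
      using assms by (intro nn_integral_cong) (auto simp: indicator_def)
    also have "\<dots> = ennreal ((W x powr (-s) - W t powr (-s)) / (-s))"
      using assms Wt by (intro nn_integral_powr_Icc) auto
    also have "\<dots> \<le> ennreal (W t powr (- s) / s)"
      using assms by (intro ennreal_leI) (auto simp: field_simps)
    finally show "(\<integral>\<^sup>+ u. ?f u * indicator {1 / Suc n<..} u \<partial>half_line) \<le> ennreal (W t powr (- s) / s)" .
  qed
  finally show ?thesis .
qed

text \<open>
  The set where \<open>W\<close> vanishes is mapped to the single point \<open>0\<close>, a null set. When \<open>\<sigma>\<close> is a negative
  power of a weight, that weight is therefore infinite almost everywhere on it, and functions of finite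
  norm vanish there.
\<close>

lemma density_zero_where_tail_zero: "AE u in half_line. W u = 0 \<longrightarrow> \<sigma> u = 0"
proof -
  have "AE u in half_line. 1 / real (Suc n) < u \<longrightarrow> W u = 0 \<longrightarrow> \<sigma> u = 0" for n
  proof -
    have "(\<integral>\<^sup>+ u. \<sigma> u * indicator {0} (W u) * indicator {1 / real (Suc n)<..} u \<partial>half_line)
        = (\<integral>\<^sup>+ y. indicator {0} y * indicator {0..W (1 / real (Suc n))} y \<partial>lborel)"
      by (subst tail_substitution) auto
    also have "\<dots> = (\<integral>\<^sup>+ (y::real). 0 \<partial>lborel)"
      using AE_lborel_singleton[of "0::real"]
      by (intro nn_integral_cong_AE) (elim eventually_mono, auto simp: indicator_def)
    finally have "(\<integral>\<^sup>+ u. \<sigma> u * indicator {0} (W u) * indicator {1 / real (Suc n)<..} u \<partial>half_line) = 0"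
      by simp
    then have "AE u in half_line. \<sigma> u * indicator {0} (W u) * indicator {1 / real (Suc n)<..} u = 0"
      by (subst (asm) nn_integral_0_iff_AE) (auto simp: indicator_greaterThan)
    then show ?thesis
      by eventually_elim (auto simp: indicator_def split: if_splits)
  qed
  then have "AE u in half_line. \<forall>n. 1 / real (Suc n) < u \<longrightarrow> W u = 0 \<longrightarrow> \<sigma> u = 0"
    unfolding AE_all_countable by blast
  moreover have "AE u in half_line. 0 < u"
    using AE_space[of half_line] by eventually_elim simp
  ultimately show ?thesis
  proof eventually_elim
    case (elim u)
    from \<open>0 < u\<close> obtain n where "1 / real (Suc n) < u"
      using nat_approx_posE[of u] by auto
    with elim show ?case by blast
  qed
qed

end

section \<open>The weight and its dual density\<close>

text \<open>
  Minimising over \<open>c\<close> up to a constant: the chosen \<open>c\<close> makes \<open>c * y powr (1 / 2)\<close> and the second term equal.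
  The factor \<open>1 / (1 / 2)\<close> is the one produced by integrating \<open>y powr (- 1 / 2)\<close>.
\<close>

lemma optimal_split:
  fixes A y p :: real
  assumes "0 < A" "0 < y" "1 < p"
  obtains c where "0 < c"
    and "c * (y powr (1 / 2) / (1 / 2)) + c powr (1 - p) * A = 3 * (y powr ((p - 1) / 2) * A) powr (1 / p)"
proof
  define c where "c = A powr (1 / p) * y powr (- 1 / (2 * p))"
  let ?R = "(y powr ((p - 1) / 2) * A) powr (1 / p)"
  show "0 < A powr (1 / p) * y powr (- 1 / (2 * p))" using assms by simp
  have R: "?R = A powr (1 / p) * y powr ((p - 1) / 2 * (1 / p))"
    using assms by (simp add: powr_mult powr_powr)
  have "- 1 / (2 * p) + 1 / 2 = (p - 1) / 2 * (1 / p)" using assms by (simp add: field_simps)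
  then have 1: "c * y powr (1 / 2) = ?R"
    unfolding c_def R mult.assoc powr_add[symmetric] by simp
  have "c powr (1 - p) * A = A powr (1 / p * (1 - p)) * A powr 1 * y powr (- 1 / (2 * p) * (1 - p))"
    using assms by (simp add: c_def powr_mult powr_powr)
  also have "\<dots> = A powr (1 / p * (1 - p) + 1) * y powr (- 1 / (2 * p) * (1 - p))"
    by (simp only: powr_add)
  also have "1 / p * (1 - p) + 1 = 1 / p" using assms by (simp add: field_simps)
  also have "- 1 / (2 * p) * (1 - p) = (p - 1) / 2 * (1 / p)" using assms by (simp add: field_simps)
  finally have 2: "c powr (1 - p) * A = ?R" unfolding R .
  have "c * (y powr (1 / 2) / (1 / 2)) + c powr (1 - p) * A = 2 * (c * y powr (1 / 2)) + c powr (1 - p) * A"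
    by simp
  also have "\<dots> = 3 * ?R" unfolding 1 2 by simp
  finally show "(A powr (1 / p) * y powr (- 1 / (2 * p))) * (y powr (1 / 2) / (1 / 2))
    + (A powr (1 / p) * y powr (- 1 / (2 * p))) powr (1 - p) * A = 3 * ?R"
    unfolding c_def .
qed

locale dual_weight =
  fixes p :: real and v :: "real \<Rightarrow> ennreal"
  assumes exponent: "1 < p"
    and weight_measurable [measurable]: "v \<in> borel_measurable half_line"
    and weight_pos: "AE t in half_line. 0 < v t"
    and tails: "0 < x \<Longrightarrow> tail_integral (\<lambda>t. epowr (v t) (1 - conj_exponent p)) x < \<infinity>"
begin

abbreviation \<sigma> :: "real \<Rightarrow> ennreal"
  where "\<sigma> t \<equiv> epowr (v t) (1 - conj_exponent p)"

sublocale finite_tail \<sigma>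
  by unfold_locales (use tails in auto)

lemma one_minus_conj_exponent: "1 - conj_exponent p = - 1 / (p - 1)"
  using exponent by (simp add: conj_exponent_def field_simps)

text \<open>
  Since \<open>p' + 1 = (2 p - 1) / (p - 1)\<close>, the weight of the second inequality is just the power
  \<open>1 - p\<close> of the tail of \<open>\<sigma>\<close>.
\<close>

lemma Psi_powr:
  assumes "0 < x"
  shows "epowr (Psi p v x) (1 - 2 * p) = epowr (ennreal (W x)) (1 - p)"
proof -
  have e: "conj_exponent p + 1 = (2 * p - 1) / (p - 1)"
    using exponent by (simp add: conj_exponent_def field_simps)
  have "1 / (conj_exponent p + 1) * (1 - 2 * p) = 1 - p"
    unfolding e using exponent by (simp add: field_simps)
  moreover have "0 < 1 / (conj_exponent p + 1)"
    unfolding e using exponent by simp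
  ultimately show ?thesis
    using assms by (simp add: Psi_def tail_eq_W epowr_epowr)
qed

lemma dual_weight_power: "AE t in half_line. epowr (\<sigma> t) p * v t = \<sigma> t"
  using weight_pos
proof eventually_elim
  case (elim t)
  show ?case
  proof (cases "v t" rule: ennreal_zero_pos_top_cases)
    case (3 y)
    define e where "e = - 1 / (p - 1)"
    have "e * p + 1 = e" using exponent by (simp add: e_def field_simps)
    then have "y powr (e * p) * y = y powr e"
      using powr_add[of y "e * p" 1] 3 by simp
    with 3 show ?thesis
      by (simp add: one_minus_conj_exponent[folded e_def] epowr_ennreal powr_powr flip: ennreal_mult)
  qed (use elim exponent in \<open>auto simp: epowr_def one_minus_conj_exponent\<close>)
qed

text \<open>
  A splitting that replaces Hoelder's inequality. With \<open>m = \<sigma> t * y powr (- 1 / 2)\<close> one has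
  \<open>m powr (1 - p) = v t * y powr ((p - 1) / 2)\<close>, so the claim reads
  \<open>a \<le> c * m + a powr p * (c * m) powr (1 - p)\<close>: either \<open>a \<le> c * m\<close>, or the second summand
  \<open>a * (a / (c * m)) powr (p - 1)\<close> is at least \<open>a\<close>. After integration, \<open>c\<close> is optimised.
\<close>

lemma split_pointwise:
  assumes "0 < v t" "0 < y" "0 < c"
  shows "a \<le> ennreal c * (\<sigma> t * ennreal (y powr (- 1 / 2)))
    + ennreal (c powr (1 - p)) * (epowr a p * v t * ennreal (y powr ((p - 1) / 2)))"
proof (cases "v t" rule: ennreal_zero_pos_top_cases)
  case 2
  then show ?thesis
    using assms exponent
    by (cases a rule: ennreal_zero_pos_top_cases)
      (auto simp: epowr_ennreal epowr_top_left[simplified] ennreal_mult_top ennreal_top_mult ennreal_mult_eq_top_iff)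
next
  case (3 z)
  show ?thesis
  proof (cases a rule: ennreal_zero_pos_top_cases)
    case a: (3 r)
    define m where "m = z powr (- 1 / (p - 1)) * y powr (- 1 / 2)"
    have m: "0 < m" using 3 assms by (simp add: m_def)
    have "m powr (1 - p) = z powr (- 1 / (p - 1) * (1 - p)) * y powr (- 1 / 2 * (1 - p))"
      using 3 assms by (simp add: m_def powr_mult powr_powr)
    also have "- 1 / (p - 1) * (1 - p) = 1" using exponent by (simp add: field_simps)
    also have "- 1 / 2 * (1 - p) = (p - 1) / 2" by (simp add: field_simps)
    finally have mp: "m powr (1 - p) = z * y powr ((p - 1) / 2)" using 3 by simp
    have "r \<le> c * m + c powr (1 - p) * (r powr p * (z * y powr ((p - 1) / 2)))"
    proof (cases "r \<le> c * m")
      case False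
      then have "1 \<le> (r / (c * m)) powr (p - 1)"
        using m assms exponent by (intro ge_one_powr_ge_zero) (auto simp: field_simps)
      then have "r \<le> r * (r / (c * m)) powr (p - 1)" using a by simp
      also have "\<dots> = c powr (1 - p) * (r powr p * m powr (1 - p))"
        using a m assms exponent
        by (simp add: powr_divide powr_mult powr_diff field_simps)
      finally show ?thesis unfolding mp using m assms by (simp add: add_increasing)
    qed (use 3 assms in \<open>auto intro: add_increasing2\<close>)
    then have "ennreal r \<le> ennreal (c * m + c powr (1 - p) * (r powr p * (z * y powr ((p - 1) / 2))))"
      by (rule ennreal_leI)
    then show ?thesis
      using 3 a m assms exponent
      by (simp add: m_def one_minus_conj_exponent epowr_ennreal ennreal_plus ennreal_mult mult.assoc)
  qed (use 3 assms exponent in \<open>auto simp: epowr_top_left[simplified] ennreal_top_mult ennreal_mult_top\<close>)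
qed (use assms in simp)

text \<open>
  Mass of \<open>h\<close> at \<open>t\<close> raises its tail by the same amount at every \<open>x < t\<close>; for the tail of \<open>f\<close> to
  have caught up there, that mass has to be spread over \<open>(t,\<infinity>)\<close>. This suggests
  \<open>f = \<sigma> * F powr (1 / p)\<close> with \<open>F u = \<integral>\<^sub>0\<^sup>u h W\<^sup>-\<^sup>p\<close>. As \<open>\<sigma>\<^sup>p v = \<sigma>\<close>, Tonelli bounds
  \<open>\<integral> f\<^sup>p v\<close> by \<open>\<integral> h W\<^sup>1\<^sup>-\<^sup>p\<close>. For the pointwise bound write \<open>h = h W\<^sup>-\<^sup>p W\<^sup>p\<close>, expand \<open>W\<^sup>p\<close> as
  \<open>p \<integral> \<sigma> W\<^sup>p\<^sup>-\<^sup>1\<close>, and exchange integrals: the tail of \<open>h\<close> is at most \<open>p \<integral> \<sigma> W\<^sup>p\<^sup>-\<^sup>1 F\<close>. Since \<open>F\<close> increases,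
  \<open>F powr (1 / p) * W\<close> is below the tail \<open>J\<close> of \<open>f\<close>, so the integrand is at most \<open>f J\<^sup>p\<^sup>-\<^sup>1\<close>, and
  the integral at most \<open>J\<^sup>p\<close>.
\<close>

lemma tail_power_dominated:
  assumes [measurable]: "h \<in> borel_measurable half_line"
    and fin: "(\<integral>\<^sup>+ t. h t * epowr (ennreal (W t)) (1 - p) \<partial>half_line) < \<infinity>"
  obtains f where "f \<in> borel_measurable half_line"
    and "(\<integral>\<^sup>+ t. epowr (f t) p * v t \<partial>half_line) \<le> (\<integral>\<^sup>+ t. h t * epowr (ennreal (W t)) (1 - p) \<partial>half_line)"
    and "\<And>x. 0 < x \<Longrightarrow> epowr (tail_integral h x) (1 / p) \<le> ennreal (p powr (1 / p)) * tail_integral f x"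
proof -
  have p: "0 < p" "0 < 1 / p" "0 < p - 1" using exponent by auto
  define k where "k t = h t * ennreal (W t powr - p)" for t
  have [measurable]: "k \<in> borel_measurable half_line" unfolding k_def by measurable
  define F where "F u = (\<integral>\<^sup>+ t. k t * indicator {..<u} t \<partial>half_line)" for u
  have [measurable]: "F \<in> borel_measurable half_line"
    unfolding F_def indicator_lessThan by measurable
  have F_mono: "F u \<le> F s" if "u \<le> s" for u s
    unfolding F_def using that by (intro nn_integral_mono) (auto simp: indicator_def)
  define f where "f u = \<sigma> u * epowr (F u) (1 / p)" for u
  have f [measurable]: "f \<in> borel_measurable half_line" unfolding f_def by measurable
  have norm: "(\<integral>\<^sup>+ t. epowr (f t) p * v t \<partial>half_line) \<le> (\<integral>\<^sup>+ t. h t * epowr (ennreal (W t)) (1 - p) \<partial>half_line)"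
  proof -
    have "AE u in half_line. epowr (f u) p * v u = \<sigma> u * F u"
      using dual_weight_power
      by eventually_elim (use p in \<open>simp add: f_def epowr_mult epowr_epowr ac_simps\<close>)
    then have "(\<integral>\<^sup>+ t. epowr (f t) p * v t \<partial>half_line) = (\<integral>\<^sup>+ u. \<sigma> u * F u \<partial>half_line)"
      by (rule nn_integral_cong_AE)
    also have "\<dots> = (\<integral>\<^sup>+ t. k t * (\<integral>\<^sup>+ u. \<sigma> u * indicator {t<..} u \<partial>half_line) \<partial>half_line)"
      unfolding F_def by (rule tonelli_triangle[symmetric]) measurable
    also have "\<dots> \<le> (\<integral>\<^sup>+ t. h t * epowr (ennreal (W t)) (1 - p) \<partial>half_line)"
    proof (rule nn_integral_mono)
      fix t assume t: "t \<in> space half_line"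
      have "W t powr - p * W t = W t powr (1 - p)" if "0 < W t"
        using that by (simp add: powr_diff powr_minus field_simps)
      then have "ennreal (W t powr - p) * ennreal (W t) \<le> epowr (ennreal (W t)) (1 - p)"
        by (cases "W t = 0") (auto simp: epowr_ennreal less_le simp flip: ennreal_mult)
      moreover have "(\<integral>\<^sup>+ u. \<sigma> u * indicator {t<..} u \<partial>half_line) = ennreal (W t)"
        using t by (simp flip: tail_eq_W add: tail_integral_half_line)
      ultimately show "k t * (\<integral>\<^sup>+ u. \<sigma> u * indicator {t<..} u \<partial>half_line) \<le> h t * epowr (ennreal (W t)) (1 - p)"
        unfolding k_def by (simp add: mult.assoc mult_left_mono)
    qed
    finally show ?thesis .
  qed
  have "AE t in half_line. h t * epowr (ennreal (W t)) (1 - p) \<noteq> \<infinity>"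
    using fin by (intro nn_integral_PInf_AE) (auto simp: less_top)
  then have zero: "AE t in half_line. W t = 0 \<longrightarrow> h t = 0"
    by eventually_elim (use p in \<open>auto simp: epowr_def ennreal_mult_eq_top_iff\<close>)
  have bound: "epowr (tail_integral h x) (1 / p) \<le> ennreal (p powr (1 / p)) * tail_integral f x" if x: "0 < x" for x
  proof -
    define J where "J = tail_integral f x"
    define b where "b u = \<sigma> u * ennreal (W u powr (p - 1))" for u
    have [measurable]: "b \<in> borel_measurable half_line" unfolding b_def by measurable
    have [measurable]: "(\<lambda>t. k t * indicator {x<..} t) \<in> borel_measurable half_line"
      unfolding indicator_greaterThan by measurable
    have "tail_integral h x = (\<integral>\<^sup>+ t. h t * indicator {x<..} t \<partial>half_line)"
      using x by (simp add: tail_integral_half_line)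
    also have "\<dots> \<le> (\<integral>\<^sup>+ t. ennreal p * ((k t * indicator {x<..} t) * (\<integral>\<^sup>+ u. b u * indicator {t<..} u \<partial>half_line)) \<partial>half_line)"
    proof (rule nn_integral_mono_AE)
      show "AE t in half_line. h t * indicator {x<..} t
        \<le> ennreal p * ((k t * indicator {x<..} t) * (\<integral>\<^sup>+ u. b u * indicator {t<..} u \<partial>half_line))"
        using zero AE_space
      proof eventually_elim
        case (elim t)
        have "(\<integral>\<^sup>+ u. b u * indicator {t<..} u \<partial>half_line) = ennreal (W t powr p / p)"
          using integral_powr_tail[of t p] elim p by (simp add: b_def)
        moreover have "ennreal p * (ennreal (W t powr - p) * ennreal (W t powr p / p)) = 1" if "0 < W t"
          using that p by (simp add: powr_minus field_simps flip: ennreal_mult ennreal_1)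
        then have "ennreal p * (k t * ennreal (W t powr p / p)) = h t" if "0 < W t"
          using that unfolding k_def by (metis (no_types, lifting) mult.assoc mult.commute mult.right_neutral)
        ultimately show ?case
          using elim by (cases "W t = 0") (auto simp: less_le indicator_def)
      qed
    qed
    also have "\<dots> = ennreal p * (\<integral>\<^sup>+ t. (k t * indicator {x<..} t) * (\<integral>\<^sup>+ u. b u * indicator {t<..} u \<partial>half_line) \<partial>half_line)"
      unfolding indicator_greaterThan by (rule nn_integral_cmult) measurable
    also have "(\<integral>\<^sup>+ t. (k t * indicator {x<..} t) * (\<integral>\<^sup>+ u. b u * indicator {t<..} u \<partial>half_line) \<partial>half_line)
        = (\<integral>\<^sup>+ u. b u * (\<integral>\<^sup>+ t. k t * indicator {x<..} t * indicator {..<u} t \<partial>half_line) \<partial>half_line)"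
      by (rule tonelli_triangle) measurable
    also have "\<dots> \<le> (\<integral>\<^sup>+ u. epowr J (p - 1) * (f u * indicator {x<..} u) \<partial>half_line)"
    proof (rule nn_integral_mono)
      fix u assume "u \<in> space half_line"
      show "b u * (\<integral>\<^sup>+ t. k t * indicator {x<..} t * indicator {..<u} t \<partial>half_line)
          \<le> epowr J (p - 1) * (f u * indicator {x<..} u)"
      proof (cases "x < u")
        case True
        have inner: "(\<integral>\<^sup>+ t. k t * indicator {x<..} t * indicator {..<u} t \<partial>half_line) \<le> F u"
          unfolding F_def by (intro nn_integral_mono) (auto simp: indicator_def)
        have "epowr (F u) (1 / p) * ennreal (W u) = (\<integral>\<^sup>+ s. epowr (F u) (1 / p) * (\<sigma> s * indicator {u<..} s) \<partial>half_line)"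
          using True x
          by (subst nn_integral_cmult) (auto simp flip: tail_eq_W simp: tail_integral_half_line)
        also have "\<dots> \<le> (\<integral>\<^sup>+ s. f s * indicator {x<..} s \<partial>half_line)"
        proof (rule nn_integral_mono)
          fix s
          have "epowr (F u) (1 / p) \<le> epowr (F s) (1 / p)" if "u < s"
            using that p by (intro epowr_mono F_mono) auto
          then show "epowr (F u) (1 / p) * (\<sigma> s * indicator {u<..} s) \<le> f s * indicator {x<..} s"
            using True by (auto simp: f_def indicator_def mult.commute[of "\<sigma> s"] intro: mult_right_mono)
        qed
        also have "\<dots> = J" using x by (simp add: J_def tail_integral_half_line)
        finally have J: "epowr (F u) (1 / p) * ennreal (W u) \<le> J" .
        have "F u = epowr (F u) (1 / p + (p - 1) / p)"
          using p by (simp flip: add_divide_distrib)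
        also have "\<dots> = epowr (F u) (1 / p) * epowr (F u) ((p - 1) / p)"
          using p by (intro epowr_add) auto
        also have "epowr (F u) ((p - 1) / p) = epowr (epowr (F u) (1 / p)) (p - 1)"
          using p by (simp add: epowr_epowr)
        finally have "ennreal (W u powr (p - 1)) * F u
            = ennreal (W u powr (p - 1)) * (epowr (F u) (1 / p) * epowr (epowr (F u) (1 / p)) (p - 1))"
          by (rule arg_cong)
        also have "\<dots> = epowr (F u) (1 / p) * epowr (epowr (F u) (1 / p) * ennreal (W u)) (p - 1)"
          using p by (simp add: epowr_mult epowr_ennreal_nonneg ac_simps)
        also have "\<dots> \<le> epowr (F u) (1 / p) * epowr J (p - 1)"
          using J p by (intro mult_left_mono epowr_mono) auto
        finally have "b u * F u \<le> \<sigma> u * (epowr (F u) (1 / p) * epowr J (p - 1))"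
          unfolding b_def mult.assoc by (intro mult_left_mono) auto
        also have "\<dots> = epowr J (p - 1) * (f u * indicator {x<..} u)"
          using True by (simp add: f_def ac_simps)
        finally show ?thesis
          using inner by (meson mult_left_mono order_trans zero_le)
      next
        case False
        then have "(\<integral>\<^sup>+ t. k t * indicator {x<..} t * indicator {..<u} t \<partial>half_line) = (\<integral>\<^sup>+ t. 0 \<partial>half_line)"
          by (intro nn_integral_cong) (auto simp: indicator_def)
        then show ?thesis by simp
      qed
    qed
    also have "\<dots> = epowr J (p - 1) * J"
      using x unfolding indicator_greaterThan
      by (subst nn_integral_cmult) (auto simp: J_def tail_integral_half_line indicator_greaterThan)
    also have "\<dots> = epowr J p"
      using p epowr_add[of "p - 1" 1 J] by simp
    finally have "tail_integral h x \<le> ennreal p * epowr J p"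
      by (simp add: mult_left_mono)
    then have "epowr (tail_integral h x) (1 / p) \<le> epowr (ennreal p * epowr J p) (1 / p)"
      using p by (intro epowr_mono)
    also have "\<dots> = ennreal (p powr (1 / p)) * J"
      using p by (simp add: epowr_mult epowr_epowr epowr_ennreal)
    finally show ?thesis unfolding J_def .
  qed
  show ?thesis using that[OF f norm bound] .
qed

text \<open>
  With \<open>b = (p - 1) / 2\<close>, \<open>k = h\<^sup>p v W\<^sup>b\<close> and \<open>K\<close> the tail of \<open>k\<close>, optimising \<open>c\<close> in the integrated
  splitting of \<open>h\<close> bounds the \<open>p\<close>-th power of the tail of \<open>h\<close> by a multiple of
  \<open>W\<^sup>b K\<close>. The function \<open>g = W\<^sup>b k + b \<sigma> W\<^sup>b\<^sup>-\<^sup>1 K\<close> is minus the formal derivative of \<open>W\<^sup>b K\<close>, so its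
  tail dominates that product. In \<open>\<integral> g W\<^sup>1\<^sup>-\<^sup>p\<close> the first summand is the integral of \<open>h\<^sup>p v\<close>, because
  \<open>2 b = p - 1\<close>, and the second is at most the same by Tonelli, because \<open>b \<sigma> W powr (- b - 1)\<close>
  integrates to at most \<open>W t powr (- b)\<close> over \<open>(0,t)\<close>. Any \<open>b\<close> strictly between \<open>0\<close> and \<open>p - 1\<close> would
  do; the midpoint keeps the exponents symmetric.
\<close>

lemma tail_dominated_by_power:
  assumes [measurable]: "h \<in> borel_measurable half_line"
    and fin: "(\<integral>\<^sup>+ t. epowr (h t) p * v t \<partial>half_line) < \<infinity>"
  obtains g where "g \<in> borel_measurable half_line"
    and "(\<integral>\<^sup>+ t. g t * epowr (ennreal (W t)) (1 - p) \<partial>half_line) \<le> 2 * (\<integral>\<^sup>+ t. epowr (h t) p * v t \<partial>half_line)"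
    and "\<And>x. 0 < x \<Longrightarrow> tail_integral h x \<le> 3 * epowr (tail_integral g x) (1 / p)"
proof -
  have p: "0 < p" "0 < 1 / p" "0 < p - 1" using exponent by auto
  define b where "b = (p - 1) / 2"
  have b: "0 < b" "1 - p = - b - b" using p by (auto simp: b_def)
  let ?N = "\<integral>\<^sup>+ t. epowr (h t) p * v t \<partial>half_line"
  define k where "k t = epowr (h t) p * v t * ennreal (W t powr b)" for t
  have [measurable]: "k \<in> borel_measurable half_line" unfolding k_def by measurable
  define K where "K u = (\<integral>\<^sup>+ t. k t * indicator {u<..} t \<partial>half_line)" for u
  have [measurable]: "K \<in> borel_measurable half_line"
    unfolding K_def indicator_greaterThan by measurable
  define g where "g u = ennreal (W u powr b) * k u + ennreal b * (\<sigma> u * ennreal (W u powr (b - 1)) * K u)" for u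
  have g [measurable]: "g \<in> borel_measurable half_line" unfolding g_def by measurable
  have norm: "(\<integral>\<^sup>+ t. g t * epowr (ennreal (W t)) (1 - p) \<partial>half_line) \<le> 2 * ?N"
  proof -
    define s where "s u = \<sigma> u * ennreal (W u powr (- b - 1))" for u
    have [measurable]: "s \<in> borel_measurable half_line" unfolding s_def by measurable
    have "g u * epowr (ennreal (W u)) (1 - p) \<le> epowr (h u) p * v u + ennreal b * (s u * K u)" for u
    proof (cases "W u = 0")
      case False
      then have W: "0 < W u" by (simp add: less_le)
      have "W u powr b * W u powr b * W u powr (1 - p) = 1"
        using W b by (simp flip: powr_add)
      then have "ennreal (W u powr b) * ennreal (W u powr b) * epowr (ennreal (W u)) (1 - p) = 1"
        using W by (simp add: epowr_ennreal flip: ennreal_mult)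
      moreover have "ennreal (W u powr b) * k u * epowr (ennreal (W u)) (1 - p)
          = epowr (h u) p * v u * (ennreal (W u powr b) * ennreal (W u powr b) * epowr (ennreal (W u)) (1 - p))"
        unfolding k_def by (simp only: mult_ac)
      ultimately have 1: "ennreal (W u powr b) * k u * epowr (ennreal (W u)) (1 - p) = epowr (h u) p * v u"
        by simp
      have "W u powr (b - 1) * W u powr (1 - p) = W u powr (- b - 1)"
        unfolding powr_add[symmetric] using b by simp
      then have "ennreal (W u powr (b - 1)) * epowr (ennreal (W u)) (1 - p) = ennreal (W u powr (- b - 1))"
        using W by (simp add: epowr_ennreal flip: ennreal_mult)
      moreover have "ennreal b * (\<sigma> u * ennreal (W u powr (b - 1)) * K u) * epowr (ennreal (W u)) (1 - p)
          = ennreal b * (\<sigma> u * (ennreal (W u powr (b - 1)) * epowr (ennreal (W u)) (1 - p)) * K u)"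
        by (simp only: mult_ac)
      ultimately have 2: "ennreal b * (\<sigma> u * ennreal (W u powr (b - 1)) * K u) * epowr (ennreal (W u)) (1 - p)
          = ennreal b * (s u * K u)"
        unfolding s_def by (simp only:)
      show ?thesis unfolding g_def distrib_right 1 2 ..
    qed (simp add: g_def k_def)
    then have "(\<integral>\<^sup>+ t. g t * epowr (ennreal (W t)) (1 - p) \<partial>half_line)
        \<le> (\<integral>\<^sup>+ u. epowr (h u) p * v u + ennreal b * (s u * K u) \<partial>half_line)"
      by (intro nn_integral_mono)
    also have "\<dots> = ?N + ennreal b * (\<integral>\<^sup>+ u. s u * K u \<partial>half_line)"
      by (simp add: nn_integral_add nn_integral_cmult)
    also have "(\<integral>\<^sup>+ u. s u * K u \<partial>half_line)
        = (\<integral>\<^sup>+ t. k t * (\<integral>\<^sup>+ u. s u * indicator {..<t} u \<partial>half_line) \<partial>half_line)"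
      unfolding K_def by (rule tonelli_triangle) measurable
    also have "ennreal b * \<dots> = (\<integral>\<^sup>+ t. ennreal b * (k t * (\<integral>\<^sup>+ u. s u * indicator {..<t} u \<partial>half_line)) \<partial>half_line)"
      unfolding indicator_lessThan by (rule nn_integral_cmult[symmetric]) measurable
    also have "\<dots> \<le> ?N"
    proof (rule nn_integral_mono)
      fix t assume t: "t \<in> space half_line"
      show "ennreal b * (k t * (\<integral>\<^sup>+ u. s u * indicator {..<t} u \<partial>half_line)) \<le> epowr (h t) p * v t"
      proof (cases "W t = 0")
        case False
        then have W: "0 < W t" by (simp add: less_le)
        have "W t powr b * (b * (W t powr - b / b)) = 1"
          using W b by (simp add: powr_minus)
        then have "ennreal (W t powr b) * (ennreal b * ennreal (W t powr - b / b)) = 1"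
          using b by (simp flip: ennreal_mult)
        moreover have "ennreal b * (k t * ennreal (W t powr - b / b))
            = epowr (h t) p * v t * (ennreal (W t powr b) * (ennreal b * ennreal (W t powr - b / b)))"
          unfolding k_def by (simp only: mult_ac)
        ultimately have "epowr (h t) p * v t = ennreal b * (k t * ennreal (W t powr - b / b))"
          by simp
        moreover have "(\<integral>\<^sup>+ u. s u * indicator {..<t} u \<partial>half_line) \<le> ennreal (W t powr - b / b)"
          using integral_neg_powr_before[of t b] t W b by (simp add: s_def)
        ultimately show ?thesis by (simp add: mult_left_mono)
      qed (simp add: k_def)
    qed
    finally show ?thesis by (simp add: mult_2 add_left_mono)
  qed
  have lower: "ennreal (W x powr b) * K x \<le> tail_integral g x" if x: "0 < x" for x
  proof -
    define s where "s u = \<sigma> u * ennreal (W u powr (b - 1)) * indicator {x<..} u" for u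
    have [measurable]: "s \<in> borel_measurable half_line"
      unfolding s_def indicator_greaterThan by measurable
    define k' where "k' t = k t * indicator {x<..} t" for t
    have [measurable]: "k' \<in> borel_measurable half_line"
      unfolding k'_def indicator_greaterThan by measurable
    have "ennreal (W x powr b) * K x = (\<integral>\<^sup>+ t. ennreal (W x powr b) * k' t \<partial>half_line)"
      unfolding K_def by (subst nn_integral_cmult[symmetric]) (auto simp: k'_def indicator_greaterThan)
    also have "\<dots> \<le> (\<integral>\<^sup>+ t. ennreal (W t powr b) * k' t
        + ennreal b * (k' t * (\<integral>\<^sup>+ u. s u * indicator {..<t} u \<partial>half_line)) \<partial>half_line)"
    proof (rule nn_integral_mono)
      fix t
      show "ennreal (W x powr b) * k' t \<le> ennreal (W t powr b) * k' t
        + ennreal b * (k' t * (\<integral>\<^sup>+ u. s u * indicator {..<t} u \<partial>half_line))"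
      proof (cases "x < t")
        case True
        have "ennreal (W x powr b) * k' t \<le> (ennreal (W t powr b) + ennreal b * (\<integral>\<^sup>+ u. s u * indicator {..<t} u \<partial>half_line)) * k' t"
          unfolding s_def using True x b by (intro mult_right_mono powr_le_integral_between) auto
        then show ?thesis by (subst (asm) distrib_right) (simp only: mult_ac)
      qed (simp add: k'_def)
    qed
    also have "\<dots> = (\<integral>\<^sup>+ t. ennreal (W t powr b) * k' t \<partial>half_line)
        + ennreal b * (\<integral>\<^sup>+ t. k' t * (\<integral>\<^sup>+ u. s u * indicator {..<t} u \<partial>half_line) \<partial>half_line)"
      unfolding indicator_lessThan
      by (subst nn_integral_add) (auto simp: nn_integral_cmult)
    also have "(\<integral>\<^sup>+ t. k' t * (\<integral>\<^sup>+ u. s u * indicator {..<t} u \<partial>half_line) \<partial>half_line)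
        = (\<integral>\<^sup>+ u. s u * (\<integral>\<^sup>+ t. k' t * indicator {u<..} t \<partial>half_line) \<partial>half_line)"
      by (rule tonelli_triangle[symmetric]) measurable
    also have "\<dots> = (\<integral>\<^sup>+ u. s u * K u \<partial>half_line)"
    proof (rule nn_integral_cong)
      fix u
      show "s u * (\<integral>\<^sup>+ t. k' t * indicator {u<..} t \<partial>half_line) = s u * K u"
      proof (cases "x < u")
        case True
        then have "(\<integral>\<^sup>+ t. k' t * indicator {u<..} t \<partial>half_line) = K u"
          unfolding K_def k'_def by (intro nn_integral_cong) (auto simp: indicator_def)
        then show ?thesis by simp
      qed (simp add: s_def)
    qed
    also have "(\<integral>\<^sup>+ t. ennreal (W t powr b) * k' t \<partial>half_line) + ennreal b * \<dots>
        = (\<integral>\<^sup>+ u. ennreal (W u powr b) * k' u + ennreal b * (s u * K u) \<partial>half_line)"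
      by (simp add: nn_integral_add nn_integral_cmult)
    also have "\<dots> = (\<integral>\<^sup>+ u. g u * indicator {x<..} u \<partial>half_line)"
      by (intro nn_integral_cong) (auto simp: g_def k'_def s_def indicator_def)
    finally show ?thesis using x by (simp add: tail_integral_half_line)
  qed
  have "AE t in half_line. epowr (h t) p * v t \<noteq> \<infinity>"
    using fin by (intro nn_integral_PInf_AE) (auto simp: less_top)
  then have zero: "AE t in half_line. W t = 0 \<longrightarrow> h t = 0"
    using density_zero_where_tail_zero weight_pos
  proof eventually_elim
    case (elim t)
    show ?case
    proof
      assume "W t = 0"
      then have "v t = \<infinity>"
        using elim p
        by (cases "v t" rule: ennreal_zero_pos_top_cases) (auto simp: epowr_ennreal)
      then show "h t = 0"
        using elim p
        by (cases "h t" rule: ennreal_zero_pos_top_cases)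
          (auto simp: epowr_ennreal epowr_top_left[simplified] ennreal_mult_top)
    qed
  qed
  have bound: "tail_integral h x \<le> 3 * epowr (tail_integral g x) (1 / p)" if x: "0 < x" for x
  proof -
    have "K x \<le> (\<integral>\<^sup>+ t. ennreal (W x powr b) * (epowr (h t) p * v t) \<partial>half_line)"
      unfolding K_def
    proof (rule nn_integral_mono)
      fix t
      have "ennreal (W t powr b) \<le> ennreal (W x powr b)" if "x < t"
        using that x b W_antimono[of x t] by (intro ennreal_leI powr_mono2) auto
      then show "k t * indicator {x<..} t \<le> ennreal (W x powr b) * (epowr (h t) p * v t)"
        unfolding k_def by (auto simp: indicator_def mult.commute[of "epowr (h t) p * v t"] intro: mult_right_mono)
    qed
    also have "\<dots> = ennreal (W x powr b) * ?N" by (rule nn_integral_cmult) measurable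
    finally have K: "K x \<le> ennreal (W x powr b) * ?N" .
    also have "\<dots> < \<infinity>" using fin by (simp add: ennreal_mult_less_top)
    finally obtain A where A: "0 \<le> A" "K x = ennreal A" by (cases "K x") auto
    \<comment> \<open>Integrating the pointwise splitting; where \<open>W\<close> vanishes the splitting is unavailable, but there \<open>h\<close> vanishes.\<close>
    have split: "tail_integral h x \<le> ennreal (c * (W x powr (1 / 2) / (1 / 2)) + c powr (1 - p) * A)"
      if c: "0 < c" for c
    proof -
      have "tail_integral h x = (\<integral>\<^sup>+ t. h t * indicator {x<..} t \<partial>half_line)"
        using x by (simp add: tail_integral_half_line)
      also have "\<dots> \<le> (\<integral>\<^sup>+ t. ennreal c * (\<sigma> t * ennreal (W t powr (1 / 2 - 1)) * indicator {x<..} t)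
          + ennreal (c powr (1 - p)) * (k t * indicator {x<..} t) \<partial>half_line)"
      proof (rule nn_integral_mono_AE)
        show "AE t in half_line. h t * indicator {x<..} t
          \<le> ennreal c * (\<sigma> t * ennreal (W t powr (1 / 2 - 1)) * indicator {x<..} t)
            + ennreal (c powr (1 - p)) * (k t * indicator {x<..} t)"
          using zero weight_pos
        proof eventually_elim
          case (elim t)
          show ?case
          proof (cases "W t = 0")
            case False
            then have "0 < W t" by (simp add: less_le)
            from split_pointwise[of t, OF elim(2) this c, of "h t"] show ?thesis
              by (auto simp: k_def b_def indicator_def)
          qed (use elim in simp)
        qed
      qed
      also have "\<dots> = ennreal c * (\<integral>\<^sup>+ t. \<sigma> t * ennreal (W t powr (1 / 2 - 1)) * indicator {x<..} t \<partial>half_line)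
          + ennreal (c powr (1 - p)) * K x"
        unfolding K_def indicator_greaterThan by (subst nn_integral_add) (auto simp: nn_integral_cmult)
      also have "\<dots> = ennreal c * ennreal (W x powr (1 / 2) / (1 / 2)) + ennreal (c powr (1 - p)) * ennreal A"
        using integral_powr_tail[of x "1 / 2"] x A by simp
      also have "\<dots> = ennreal (c * (W x powr (1 / 2) / (1 / 2)) + c powr (1 - p) * A)"
        using c A by (simp add: ennreal_plus ennreal_mult)
      finally show ?thesis .
    qed
    have "tail_integral h x \<le> ennreal (3 * (W x powr b * A) powr (1 / p))"
    proof (cases "A = 0")
      case True
      \<comment> \<open>The second summand is absent, so letting \<open>c\<close> tend to \<open>0\<close> shows that the tail is \<open>0\<close>.\<close>
      define B where "B = W x powr (1 / 2) / (1 / 2)"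
      have B: "0 \<le> B" by (simp add: B_def)
      have "tail_integral h x \<le> 0 + ennreal e" if "0 < e" for e
      proof -
        have "tail_integral h x \<le> ennreal (e / (B + 1) * B)"
          using split[of "e / (B + 1)"] that B unfolding B_def[symmetric] True by simp
        also have "\<dots> \<le> ennreal e"
          using that B by (intro ennreal_leI) (simp add: field_simps)
        finally show ?thesis by simp
      qed
      then have "tail_integral h x \<le> 0" by (rule ennreal_le_epsilon)
      then show ?thesis by simp
    next
      case False
      then have "W x \<noteq> 0" using K A by auto
      then have "0 < W x" "0 < A" using False A by (auto simp: less_le)
      then obtain c where c: "0 < c" "c * (W x powr (1 / 2) / (1 / 2)) + c powr (1 - p) * A = 3 * (W x powr b * A) powr (1 / p)"
        using optimal_split[of A "W x" p] exponent unfolding b_def by blast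
      then show ?thesis using split[of c] by simp
    qed
    also have "\<dots> = 3 * epowr (ennreal (W x powr b) * K x) (1 / p)"
    proof -
      have "ennreal (W x powr b) * K x = ennreal (W x powr b * A)"
        using A by (simp flip: ennreal_mult)
      moreover have "epowr (ennreal (W x powr b * A)) (1 / p) = ennreal ((W x powr b * A) powr (1 / p))"
        using A p by (intro epowr_ennreal_nonneg) auto
      ultimately show ?thesis by (simp add: ennreal_mult'')
    qed
    also have "\<dots> \<le> 3 * epowr (tail_integral g x) (1 / p)"
      using lower[OF x] p by (intro mult_left_mono epowr_mono) auto
    finally show ?thesis .
  qed
  show ?thesis using that[OF g norm bound] .
qed

end

section \<open>Weighted norms and the operator\<close>

lemma weighted_norm_power:
  assumes "0 < q" "0 < p"
  shows "weighted_norm (q / p) w (\<lambda>x. epowr (F x) p) = epowr (weighted_norm q w F) p"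
  using assms unfolding weighted_norm_def by (simp add: epowr_epowr)

lemma weighted_norm_le:
  assumes "0 < q" "0 < a" and [measurable]: "G \<in> borel_measurable half_line" "w \<in> borel_measurable half_line"
    and le: "AE x in half_line. F x \<le> ennreal a * G x"
  shows "weighted_norm q w F \<le> ennreal a * weighted_norm q w G"
proof -
  have "(\<integral>\<^sup>+ x. epowr (F x) q * w x \<partial>half_line) \<le> (\<integral>\<^sup>+ x. ennreal (a powr q) * (epowr (G x) q * w x) \<partial>half_line)"
  proof (rule nn_integral_mono_AE)
    show "AE x in half_line. epowr (F x) q * w x \<le> ennreal (a powr q) * (epowr (G x) q * w x)"
      using le
    proof eventually_elim
      case (elim x)
      then have "epowr (F x) q \<le> epowr (ennreal a * G x) q" using assms by (intro epowr_mono)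
      then show ?case
        using assms by (simp add: epowr_mult epowr_ennreal flip: mult.assoc) (intro mult_right_mono, auto)
    qed
  qed
  also have "\<dots> = ennreal (a powr q) * (\<integral>\<^sup>+ x. epowr (G x) q * w x \<partial>half_line)"
    by (rule nn_integral_cmult) measurable
  finally have "weighted_norm q w F \<le> epowr (ennreal (a powr q) * (\<integral>\<^sup>+ x. epowr (G x) q * w x \<partial>half_line)) (1 / q)"
    unfolding weighted_norm_def using assms by (intro epowr_mono) auto
  also have "\<dots> = ennreal a * weighted_norm q w G"
    unfolding weighted_norm_def using assms by (simp add: epowr_mult epowr_ennreal powr_powr)
  finally show ?thesis .
qed

text \<open>
  The only way in which the operator enters: a pointwise bound between arguments passes to the norms
  of their images, with one constant for all arguments.
\<close>

lemma (in monotone_quasilinear) weighted_norm_operator_le: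
  assumes "0 < q" "w \<in> Mplus"
  obtains c where "0 < c"
    and "\<And>f g a. f \<in> Mplus \<Longrightarrow> g \<in> Mplus \<Longrightarrow> 0 < a \<Longrightarrow> (\<And>x. 0 < x \<Longrightarrow> f x \<le> ennreal a * g x)
      \<Longrightarrow> weighted_norm q w (T f) \<le> ennreal (c * a) * weighted_norm q w (T g)"
proof -
  obtain c where c: "0 < c" and mono: "\<And>f g. f \<in> Mplus \<Longrightarrow> g \<in> Mplus \<Longrightarrow> AE x in half_line. f x \<le> g x
      \<Longrightarrow> AE x in half_line. T f x \<le> ennreal c * T g x"
    using monotone_ae by blast
  show ?thesis
  proof (rule that[OF c])
    fix f g and a :: real
    assume fg: "f \<in> Mplus" "g \<in> Mplus" and a: "0 < a" and le: "\<And>x. 0 < x \<Longrightarrow> f x \<le> ennreal a * g x"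
    have "(\<lambda>x. ennreal a * g x) \<in> Mplus" using fg unfolding Mplus_def by measurable
    then have "AE x in half_line. T f x \<le> ennreal c * T (\<lambda>x. ennreal a * g x) x"
      using fg le by (intro mono AE_I2) auto
    moreover have "AE x in half_line. T (\<lambda>x. ennreal a * g x) x = ennreal a * T g x"
      using fg a by (intro homogeneous_ae) auto
    ultimately have "AE x in half_line. T f x \<le> ennreal (c * a) * T g x"
      by eventually_elim (use a c in \<open>simp add: ennreal_mult mult.assoc\<close>)
    then show "weighted_norm q w (T f) \<le> ennreal (c * a) * weighted_norm q w (T g)"
      using assms a c fg maps_Mplus[of g] by (intro weighted_norm_le) (auto simp: Mplus_def)
  qed
qed

theorem theorem1p6:
  fixes p q :: real
    and T :: "(real \<Rightarrow> ennreal) \<Rightarrow> (real \<Rightarrow> ennreal)"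
    and v w :: "real \<Rightarrow> ennreal"
  assumes "0 < q" and "1 < p"
    and "monotone_quasilinear T"
    and "w \<in> weights" and "v \<in> weights"
    and "\<And>x. 0 < x \<Longrightarrow> tail_integral (\<lambda>t. epowr (v t) (1 - conj_exponent p)) x < \<infinity>"
  shows "(\<exists>C>0::real. \<forall>h\<in>Mplus.
            weighted_norm q w (T (\<lambda>x. tail_integral h x))
              \<le> ennreal C * weighted_norm p v h) \<longleftrightarrow>
         (\<exists>C>0::real. \<forall>h\<in>Mplus.
            weighted_norm (q / p) w (\<lambda>x. epowr (T (\<lambda>y. epowr (tail_integral h y) (1 / p)) x) p)
              \<le> ennreal (C powr p) * weighted_norm 1 (\<lambda>x. epowr (Psi p v x) (1 - 2 * p)) h)"
proof -
  interpret monotone_quasilinear T by fact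
  interpret dual_weight p v
    by unfold_locales (use assms in \<open>auto simp: weights_def Mplus_def\<close>)
  have p: "0 < p" "0 < 1 / p" using assms by auto
  let ?N = "\<lambda>h. \<integral>\<^sup>+ t. epowr (h t) p * v t \<partial>half_line"
  let ?M = "\<lambda>h. \<integral>\<^sup>+ t. h t * epowr (ennreal (W t)) (1 - p) \<partial>half_line"
  let ?S = "\<lambda>h x. epowr (tail_integral h x) (1 / p)"
  have tail_Mplus: "tail_integral h \<in> Mplus" if "h \<in> Mplus" for h
    using that tail_integral_measurable by (simp add: Mplus_def)
  have root_Mplus: "?S h \<in> Mplus" if "h \<in> Mplus" for h
    using measurable_compose[OF _ epowr_measurable] tail_Mplus[OF that] by (simp add: Mplus_def)
  have "weighted_norm 1 (\<lambda>x. epowr (Psi p v x) (1 - 2 * p)) h = ?M h" for h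
    unfolding weighted_norm_def by (auto simp: Psi_powr intro!: nn_integral_cong)
  moreover have "epowr a p \<le> ennreal (C powr p) * b \<longleftrightarrow> a \<le> ennreal C * epowr b (1 / p)"
    if "0 < C" for a b C
    using that p by (simp add: epowr_le_iff_root epowr_mult epowr_ennreal powr_powr)
  ultimately have second: "weighted_norm (q / p) w (\<lambda>x. epowr (T (?S h) x) p)
        \<le> ennreal (C powr p) * weighted_norm 1 (\<lambda>x. epowr (Psi p v x) (1 - 2 * p)) h
      \<longleftrightarrow> weighted_norm q w (T (?S h)) \<le> ennreal C * epowr (?M h) (1 / p)" if "0 < C" for h C
    using that assms p by (simp add: weighted_norm_power)
  obtain c where c: "0 < c"
    and transfer: "\<And>f g a. f \<in> Mplus \<Longrightarrow> g \<in> Mplus \<Longrightarrow> 0 < a \<Longrightarrow> (\<And>x. 0 < x \<Longrightarrow> f x \<le> ennreal a * g x)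
      \<Longrightarrow> weighted_norm q w (T f) \<le> ennreal (c * a) * weighted_norm q w (T g)"
    using weighted_norm_operator_le[OF assms(1), of w] assms(4) unfolding weights_def by blast
  show ?thesis
  proof (intro iffI; elim exE conjE)
    fix C :: real
    assume C: "0 < C" and *: "\<forall>h\<in>Mplus. weighted_norm q w (T (\<lambda>x. tail_integral h x)) \<le> ennreal C * weighted_norm p v h"
    define D where "D = c * p powr (1 / p) * C"
    have D: "0 < D" using C c p by (simp add: D_def)
    \<comment> \<open>An infinite right-hand side makes the inequality trivial, since \<open>D\<close> is positive.\<close>
    have "weighted_norm q w (T (?S h)) \<le> ennreal D * epowr (?M h) (1 / p)" if h: "h \<in> Mplus" for h
    proof (cases "?M h = \<infinity>")
      case False
      then obtain f where f: "f \<in> Mplus" "?N f \<le> ?M h"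
        and le: "\<And>x. 0 < x \<Longrightarrow> ?S h x \<le> ennreal (p powr (1 / p)) * tail_integral f x"
        using tail_power_dominated[of h] h unfolding Mplus_def by (auto simp: less_top)
      have "weighted_norm q w (T (?S h)) \<le> ennreal (c * p powr (1 / p)) * weighted_norm q w (T (tail_integral f))"
        using p by (intro transfer root_Mplus tail_Mplus h f le) auto
      also have "\<dots> \<le> ennreal (c * p powr (1 / p)) * (ennreal C * epowr (?N f) (1 / p))"
        using * f by (intro mult_left_mono) (auto simp: weighted_norm_def)
      also have "\<dots> = ennreal D * epowr (?N f) (1 / p)"
        using C c by (simp add: D_def ennreal_mult mult.assoc)
      also have "\<dots> \<le> ennreal D * epowr (?M h) (1 / p)"
        using f p by (intro mult_left_mono epowr_mono) auto
      finally show ?thesis .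
    qed (use D p in \<open>simp add: epowr_top_left[simplified] ennreal_mult_top\<close>)
    then show "\<exists>C>0. \<forall>h\<in>Mplus. weighted_norm (q / p) w (\<lambda>x. epowr (T (?S h) x) p)
        \<le> ennreal (C powr p) * weighted_norm 1 (\<lambda>x. epowr (Psi p v x) (1 - 2 * p)) h"
      using D second by blast
  next
    fix C :: real
    assume C: "0 < C" and "\<forall>h\<in>Mplus. weighted_norm (q / p) w (\<lambda>x. epowr (T (?S h) x) p)
        \<le> ennreal (C powr p) * weighted_norm 1 (\<lambda>x. epowr (Psi p v x) (1 - 2 * p)) h"
    then have *: "weighted_norm q w (T (?S h)) \<le> ennreal C * epowr (?M h) (1 / p)" if "h \<in> Mplus" for h
      using second that by blast
    define D where "D = c * 3 * C * 2 powr (1 / p)"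
    have D: "0 < D" using C c p by (simp add: D_def)
    have "weighted_norm q w (T (\<lambda>x. tail_integral h x)) \<le> ennreal D * epowr (?N h) (1 / p)" if h: "h \<in> Mplus" for h
    proof (cases "?N h = \<infinity>")
      case False
      then obtain g where g: "g \<in> Mplus" "?M g \<le> 2 * ?N h"
        and le: "\<And>x. 0 < x \<Longrightarrow> tail_integral h x \<le> 3 * ?S g x"
        using tail_dominated_by_power[of h] h unfolding Mplus_def by (auto simp: less_top)
      have "weighted_norm q w (T (tail_integral h)) \<le> ennreal (c * 3) * weighted_norm q w (T (?S g))"
        by (intro transfer root_Mplus tail_Mplus h g) (use le in auto)
      also have "\<dots> \<le> ennreal (c * 3) * (ennreal C * epowr (?M g) (1 / p))"
        using * g by (intro mult_left_mono) auto
      also have "\<dots> \<le> ennreal (c * 3) * (ennreal C * epowr (2 * ?N h) (1 / p))"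
        using g p by (intro mult_left_mono epowr_mono) auto
      also have "epowr (2 * ?N h) (1 / p) = ennreal (2 powr (1 / p)) * epowr (?N h) (1 / p)"
        using p epowr_ennreal[of 2 "1 / p"] by (simp add: epowr_mult)
      also have "ennreal (c * 3) * (ennreal C * \<dots>) = ennreal D * epowr (?N h) (1 / p)"
        using C c by (simp add: D_def ennreal_mult mult.assoc)
      finally show ?thesis .
    qed (use D p in \<open>simp add: epowr_top_left[simplified] ennreal_mult_top\<close>)
    then show "\<exists>C>0. \<forall>h\<in>Mplus. weighted_norm q w (T (\<lambda>x. tail_integral h x)) \<le> ennreal C * weighted_norm p v h"
      using D by (auto simp: weighted_norm_def)
  qed
qed

end
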